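(* Let $R$ be a finite commutative ring with identity with Artin decomposition $R=R_1\times\cdots\times R_s$, each $R_i$ a local ring, and let $k\in\mathbb{N}$. Then $$\mathcal{G}_R(k)\simeq\bigotimes_{i=1}^s\mathcal{G}_{R_i}(k)$$ if and only if $-1\notin U_{R_j,k}$ for at most one $j\in\{1,\dots,s\}$.
   Context: For a commutative ring $R$ with identity and a positive integer $k$, $R^*$ is the group of units, $U_{R,k}=\{x^k:x\in R^*\}$ and $T_{R,k}=U_{R,k}\cup(-U_{R,k})$. For an abelian group $A$ and $S\subseteq A$ with $0\notin S$ and $S=-S$, $X(A,S)$ denotes the Cayley graph with vertex set $A$ and $v,w$ adjacent iff $w-v\in S$. The symmetrized $k$-th unitary Cayley graph is $\mathcal{G}_R(k)=X(R,T_{R,k})$. The Kronecker product $\Gamma_1\otimes\cdots\otimes\Gamma_s$ has vertex set $V(\Gamma_1)\times\cdots\times V(\Gamma_s)$, with $(v_i)$ and $(w_i)$ adjacent iff $v_i$ and $w_i$ are adjacent in $\Gamma_i$ for every $i$. $\simeq$ denotes graph isomorphism. *)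

theory Defs
  imports
    "HOL-Algebra.Algebra"
    "Graph_Theory.Pair_Digraph"
    "Graph_Theory.Digraph_Isomorphism"
begin

definition local_ring :: "('a, 'm) ring_scheme \<Rightarrow> bool" where
  "local_ring R \<longleftrightarrow> cring R \<and> (\<exists>!M. maximalideal M R)"

definition unit_powers :: "('a, 'm) ring_scheme \<Rightarrow> nat \<Rightarrow> 'a set" where
  "unit_powers R k = {x [^]\<^bsub>R\<^esub> k |x. x \<in> Units R}"

definition sym_unit_powers :: "('a, 'm) ring_scheme \<Rightarrow> nat \<Rightarrow> 'a set" where
  "sym_unit_powers R k = unit_powers R k \<union> {\<ominus>\<^bsub>R\<^esub> x |x. x \<in> unit_powers R k}"

(* Undirected graphs are represented by symmetric arc relations (locale pair_graph).
   Only the additive structure of A is used, as in the locale abelian_group. *)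
definition cayley_graph :: "('a, 'm) ring_scheme \<Rightarrow> 'a set \<Rightarrow> 'a pair_pre_digraph" where
  "cayley_graph A S =
    \<lparr> pverts = carrier A,
      parcs = {(v, w). v \<in> carrier A \<and> w \<in> carrier A \<and> w \<ominus>\<^bsub>A\<^esub> v \<in> S} \<rparr>"

definition sym_unitary_cayley_graph ::
  "('a, 'm) ring_scheme \<Rightarrow> nat \<Rightarrow> 'a pair_pre_digraph" where
  "sym_unitary_cayley_graph R k = cayley_graph R (sym_unit_powers R k)"

(* Tuples of vertices are lists of the same length as the list of factors,
   as for RDirProd_list. *)
definition kronecker_product :: "'a pair_pre_digraph list \<Rightarrow> 'a list pair_pre_digraph" where
  "kronecker_product Gs =
    \<lparr> pverts = {vs. length vs = length Gs \<and> (\<forall>i < length Gs. vs ! i \<in> pverts (Gs ! i))},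
      parcs = {(vs, ws). length vs = length Gs \<and> length ws = length Gs \<and>
                         (\<forall>i < length Gs. (vs ! i, ws ! i) \<in> parcs (Gs ! i))} \<rparr>"

abbreviation graph_iso :: "'a pair_pre_digraph \<Rightarrow> 'b pair_pre_digraph \<Rightarrow> bool" where
  "graph_iso G H \<equiv> digraph_iso (with_proj G) (with_proj H)"

lemma pair_graph_cayley_graph:
  assumes "abelian_group A" "finite (carrier A)"
    and zero: "\<zero>\<^bsub>A\<^esub> \<notin> S" and sym: "\<And>x. x \<in> S \<Longrightarrow> \<ominus>\<^bsub>A\<^esub> x \<in> S"
  shows "pair_graph (cayley_graph A S)"
proof -
  interpret abelian_group A by fact
  have fin: "finite {(v, w). v \<in> carrier A \<and> w \<in> carrier A \<and> w \<ominus>\<^bsub>A\<^esub> v \<in> S}"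
    by (rule finite_subset[of _ "carrier A \<times> carrier A"]) (use assms(2) in auto)
  have flip: "v \<ominus>\<^bsub>A\<^esub> w \<in> S" if "v \<in> carrier A" "w \<in> carrier A" "w \<ominus>\<^bsub>A\<^esub> v \<in> S" for v w
  proof -
    have "\<ominus>\<^bsub>A\<^esub> (w \<ominus>\<^bsub>A\<^esub> v) = v \<ominus>\<^bsub>A\<^esub> w"
      using that(1,2) by (simp add: a_minus_def minus_add a_comm)
    then show ?thesis using sym[OF that(3)] by simp
  qed
  have loopfree: "v \<ominus>\<^bsub>A\<^esub> v \<notin> S" if "v \<in> carrier A" for v
    using that zero by (simp add: a_minus_def r_neg)
  let ?G = "cayley_graph A S"
  show ?thesis
  proof unfold_locales
    show "fst e \<in> pverts ?G" "snd e \<in> pverts ?G" "fst e \<noteq> snd e" if "e \<in> parcs ?G" for e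
      using that loopfree by (auto simp: cayley_graph_def)
    show "finite (pverts ?G)" "finite (parcs ?G)"
      using assms(2) fin by (simp_all add: cayley_graph_def)
    show "symmetric (with_proj ?G)"
      unfolding symmetric_def sym_def using flip by (simp add: cayley_graph_def)
  qed
qed

lemma pair_graph_sym_unitary_cayley_graph:
  assumes "cring R" "finite (carrier R)" "\<one>\<^bsub>R\<^esub> \<noteq> \<zero>\<^bsub>R\<^esub>"
  shows "pair_graph (sym_unitary_cayley_graph R k)"
proof -
  interpret cring R by fact
  have U: "unit_powers R k \<subseteq> Units R"
    by (auto simp: unit_powers_def intro: Units_pow_closed)
  have zU: "\<zero>\<^bsub>R\<^esub> \<notin> Units R"
    using assms(3) by (auto simp: Units_def)
  have "\<ominus>\<^bsub>R\<^esub> x \<noteq> \<zero>\<^bsub>R\<^esub>" if "x \<in> unit_powers R k" for x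
    using that U zU by (metis Units_closed minus_minus minus_zero subsetD)
  then have zero: "\<zero>\<^bsub>R\<^esub> \<notin> sym_unit_powers R k"
    using U zU by (fastforce simp: sym_unit_powers_def)
  have sym: "\<ominus>\<^bsub>R\<^esub> x \<in> sym_unit_powers R k" if "x \<in> sym_unit_powers R k" for x
    using that U by (auto simp: sym_unit_powers_def) (metis Units_closed minus_minus subsetD)
  show ?thesis
    unfolding sym_unitary_cayley_graph_def
    by (rule pair_graph_cayley_graph) (use assms zero sym abelian_group_axioms in auto)
qed

end

theory Submission
  imports Defs
begin

text \<open>
  Write \<open>U\<^sub>i\<close> for the \<open>k\<close>-th powers of units of \<open>R\<^sub>i\<close> and \<open>T\<^sub>i = U\<^sub>i \<union> - U\<^sub>i\<close>. A ring isomorphism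
  is an isomorphism of the Cayley graphs, so \<open>R\<close> may be replaced by the product \<open>P\<close> of the \<open>R\<^sub>i\<close>.
  Then the graph of \<open>P\<close> and the Kronecker product live on the same vertex set, and an arc from
  \<open>v\<close> to \<open>w\<close> depends on the tuple \<open>x = w - v\<close> alone. Units and powers in \<open>P\<close> are componentwise,
  but the sign is global: \<open>x\<close> gives an arc in the graph of \<open>P\<close> iff all \<open>x\<^sub>i\<close> lie in \<open>U\<^sub>i\<close> or all
  \<open>- x\<^sub>i\<close> do (\<open>sym_unit_powers_RDirProd_list_iff\<close>), whereas the Kronecker product lets each
  component choose its own sign. Hence every arc of the first graph is one of the second.

  If \<open>- 1 \<in> U\<^sub>i\<close> then \<open>U\<^sub>i = - U\<^sub>i\<close> and the sign at \<open>i\<close> is immaterial. So when this fails at no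
  more than one index, the sign chosen there serves for all indices and the two graphs
  coincide. If it fails at \<open>j \<noteq> l\<close>, the tuple with entry \<open>- 1\<close> at \<open>j\<close> and \<open>1\<close> elsewhere requires
  opposite signs at \<open>j\<close> and \<open>l\<close>, so the inclusion of arc sets is strict. Thus the condition
  on the \<open>U\<^sub>i\<close> characterizes \<^emph>\<open>equality\<close> of the two graphs
  (\<open>sym_unitary_cayley_graph_eq_kronecker_iff\<close>). Finally, equality is the same as isomorphism:
  isomorphic graphs have equally many arcs, and a proper subset of a finite set of arcs has fewer
  elements.
\<close>

section \<open>Products of a list of rings, componentwise\<close>

text \<open>The operations of a list product are transported along \<open>Cons\<close> from a binary product, through
  an inverse image; on lists that lie in the carrier this yields recursion equations.\<close>

lemma RDirProd_list_Cons_ops: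
  assumes "a \<in> carrier R" "b \<in> carrier R"
    and "as \<in> carrier (RDirProd_list Rs)" "bs \<in> carrier (RDirProd_list Rs)"
  shows "(a # as) \<otimes>\<^bsub>RDirProd_list (R # Rs)\<^esub> (b # bs) =
           (a \<otimes>\<^bsub>R\<^esub> b) # (as \<otimes>\<^bsub>RDirProd_list Rs\<^esub> bs)"
    and "(a # as) \<oplus>\<^bsub>RDirProd_list (R # Rs)\<^esub> (b # bs) =
           (a \<oplus>\<^bsub>R\<^esub> b) # (as \<oplus>\<^bsub>RDirProd_list Rs\<^esub> bs)"
proof -
  have "(a, as) \<in> carrier (RDirProd R (RDirProd_list Rs))"
    "(b, bs) \<in> carrier (RDirProd R (RDirProd_list Rs))"
    using assms by (simp_all add: RDirProd_carrier)
  note hom = ring_hom_memE(2,3)[OF RDirProd_list_hom1 this]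
  show "(a # as) \<otimes>\<^bsub>RDirProd_list (R # Rs)\<^esub> (b # bs) =
           (a \<otimes>\<^bsub>R\<^esub> b) # (as \<otimes>\<^bsub>RDirProd_list Rs\<^esub> bs)"
    using hom(1) by (simp add: RDirProd_def DirProd_def monoid.defs)
  show "(a # as) \<oplus>\<^bsub>RDirProd_list (R # Rs)\<^esub> (b # bs) =
           (a \<oplus>\<^bsub>R\<^esub> b) # (as \<oplus>\<^bsub>RDirProd_list Rs\<^esub> bs)"
    using hom(2) by (simp add: RDirProd_def DirProd_def monoid.defs)
qed

text \<open>That projections are homomorphisms is the source of all componentwise rules below.\<close>

lemma nth_RDirProd_list_ring_hom:
  assumes "i < length Rs"
  shows "(\<lambda>xs. xs ! i) \<in> ring_hom (RDirProd_list Rs) (Rs ! i)"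
  using assms
proof (induction Rs arbitrary: i)
  case (Cons R Rs)
  have tail: "(\<lambda>xs. xs ! i') \<in> ring_hom (RDirProd_list Rs) (Rs ! i')" if "i = Suc i'" for i'
    using Cons that by simp
  show ?case
  proof (rule ring_hom_memI)
    show "xs ! i \<in> carrier ((R # Rs) ! i)" if "xs \<in> carrier (RDirProd_list (R # Rs))" for xs
      using RDirProd_list_carrier_mem(2)[OF that] Cons.prems by blast
  next
    fix xs ys
    assume "xs \<in> carrier (RDirProd_list (R # Rs))" "ys \<in> carrier (RDirProd_list (R # Rs))"
    then obtain a as b bs where ab: "xs = a # as" "ys = b # bs"
      "a \<in> carrier R" "b \<in> carrier R"
      "as \<in> carrier (RDirProd_list Rs)" "bs \<in> carrier (RDirProd_list Rs)"
      unfolding RDirProd_list_carrier by auto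
    show "(xs \<otimes>\<^bsub>RDirProd_list (R # Rs)\<^esub> ys) ! i = xs ! i \<otimes>\<^bsub>(R # Rs) ! i\<^esub> ys ! i"
      using ab ring_hom_memE(2)[OF tail]
      by (cases i) (simp_all add: RDirProd_list_Cons_ops)
    show "(xs \<oplus>\<^bsub>RDirProd_list (R # Rs)\<^esub> ys) ! i = xs ! i \<oplus>\<^bsub>(R # Rs) ! i\<^esub> ys ! i"
      using ab ring_hom_memE(3)[OF tail]
      by (cases i) (simp_all add: RDirProd_list_Cons_ops)
  next
    show "\<one>\<^bsub>RDirProd_list (R # Rs)\<^esub> ! i = \<one>\<^bsub>(R # Rs) ! i\<^esub>"
      using ring_hom_memE(4)[OF tail] by (cases i) (simp_all add: RDirProd_list_one)
  qed
qed simp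

lemma RDirProd_list_eqI:
  assumes "xs \<in> carrier (RDirProd_list Rs)" "ys \<in> carrier (RDirProd_list Rs)"
    and "\<And>i. i < length Rs \<Longrightarrow> xs ! i = ys ! i"
  shows "xs = ys"
  using assms by (auto intro: nth_equalityI simp: RDirProd_list_carrier_mem(1))

lemma Units_ring_hom_closed:
  assumes "h \<in> ring_hom R S" "x \<in> Units R"
  shows "h x \<in> Units S"
proof -
  obtain y where y: "x \<in> carrier R" "y \<in> carrier R" "y \<otimes>\<^bsub>R\<^esub> x = \<one>\<^bsub>R\<^esub>" "x \<otimes>\<^bsub>R\<^esub> y = \<one>\<^bsub>R\<^esub>"
    using assms(2) by (auto simp: Units_def)
  note h = ring_hom_memE[OF assms(1)]
  have "h y \<otimes>\<^bsub>S\<^esub> h x = \<one>\<^bsub>S\<^esub>" "h x \<otimes>\<^bsub>S\<^esub> h y = \<one>\<^bsub>S\<^esub>"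
    using y h(2,4) by metis+
  then show ?thesis
    using h(1)[OF y(1)] h(1)[OF y(2)] by (auto simp: Units_def)
qed

context
  fixes Rs :: "('b, 'n) ring_scheme list"
  assumes rings: "\<And>S. S \<in> set Rs \<Longrightarrow> ring S"
begin

lemma ring_RDirProd_list: "ring (RDirProd_list Rs)"
  using rings by (intro RDirProd_list_is_ring) simp

lemma ring_hom_ring_nth:
  assumes "i < length Rs"
  shows "ring_hom_ring (RDirProd_list Rs) (Rs ! i) (\<lambda>xs. xs ! i)"
  using assms ring_RDirProd_list rings nth_RDirProd_list_ring_hom
  by (intro ring_hom_ringI2) auto

lemma nth_minus_RDirProd_list:
  assumes "xs \<in> carrier (RDirProd_list Rs)" "i < length Rs"
  shows "(\<ominus>\<^bsub>RDirProd_list Rs\<^esub> xs) ! i = \<ominus>\<^bsub>Rs ! i\<^esub> (xs ! i)"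
proof -
  interpret ring_hom_ring "RDirProd_list Rs" "Rs ! i" "\<lambda>xs. xs ! i"
    by (rule ring_hom_ring_nth[OF assms(2)])
  show ?thesis using assms(1) by simp
qed

lemma nth_diff_RDirProd_list:
  assumes "xs \<in> carrier (RDirProd_list Rs)" "ys \<in> carrier (RDirProd_list Rs)" "i < length Rs"
  shows "(xs \<ominus>\<^bsub>RDirProd_list Rs\<^esub> ys) ! i = xs ! i \<ominus>\<^bsub>Rs ! i\<^esub> (ys ! i)"
proof -
  interpret ring_hom_ring "RDirProd_list Rs" "Rs ! i" "\<lambda>xs. xs ! i"
    by (rule ring_hom_ring_nth[OF assms(3)])
  show ?thesis using assms(1,2) by (simp add: a_minus_def)
qed

lemma nth_pow_RDirProd_list:
  assumes "xs \<in> carrier (RDirProd_list Rs)" "i < length Rs"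
  shows "(xs [^]\<^bsub>RDirProd_list Rs\<^esub> (k::nat)) ! i = (xs ! i) [^]\<^bsub>Rs ! i\<^esub> k"
proof -
  interpret ring_hom_ring "RDirProd_list Rs" "Rs ! i" "\<lambda>xs. xs ! i"
    by (rule ring_hom_ring_nth[OF assms(2)])
  show ?thesis using assms(1) by (induction k) simp_all
qed

lemma Units_RDirProd_listI:
  assumes "length xs = length Rs" "\<And>i. i < length Rs \<Longrightarrow> xs ! i \<in> Units (Rs ! i)"
  shows "xs \<in> Units (RDirProd_list Rs)"
proof -
  let ?P = "RDirProd_list Rs"
  interpret P: ring ?P by (rule ring_RDirProd_list)
  define ys where "ys = map (\<lambda>i. inv\<^bsub>Rs ! i\<^esub> (xs ! i)) [0..<length Rs]"
  have mon: "monoid (Rs ! i)" if "i < length Rs" for i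
    using rings[OF nth_mem[OF that]] by (rule ring.is_monoid)
  have xs: "xs \<in> carrier ?P"
    using assms monoid.Units_closed[OF mon] by (intro RDirProd_list_carrier_memI) simp_all
  have ys: "ys \<in> carrier ?P"
    using assms(2) monoid.Units_inv_closed[OF mon]
    by (intro RDirProd_list_carrier_memI) (simp_all add: ys_def)
  note hom = nth_RDirProd_list_ring_hom
  have "ys \<otimes>\<^bsub>?P\<^esub> xs = \<one>\<^bsub>?P\<^esub>"
  proof (rule RDirProd_list_eqI)
    fix i assume i: "i < length Rs"
    have "(ys \<otimes>\<^bsub>?P\<^esub> xs) ! i = ys ! i \<otimes>\<^bsub>Rs ! i\<^esub> xs ! i"
      by (rule ring_hom_memE(2)[OF hom[OF i] ys xs])
    also have "\<dots> = \<one>\<^bsub>Rs ! i\<^esub>"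
      using monoid.Units_l_inv[OF mon assms(2)] i by (simp add: ys_def)
    finally show "(ys \<otimes>\<^bsub>?P\<^esub> xs) ! i = \<one>\<^bsub>?P\<^esub> ! i"
      using ring_hom_memE(4)[OF hom[OF i]] by simp
  qed (use xs ys in simp_all)
  moreover have "xs \<otimes>\<^bsub>?P\<^esub> ys = \<one>\<^bsub>?P\<^esub>"
  proof (rule RDirProd_list_eqI)
    fix i assume i: "i < length Rs"
    have "(xs \<otimes>\<^bsub>?P\<^esub> ys) ! i = xs ! i \<otimes>\<^bsub>Rs ! i\<^esub> ys ! i"
      by (rule ring_hom_memE(2)[OF hom[OF i] xs ys])
    also have "\<dots> = \<one>\<^bsub>Rs ! i\<^esub>"
      using monoid.Units_r_inv[OF mon assms(2)] i by (simp add: ys_def)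
    finally show "(xs \<otimes>\<^bsub>?P\<^esub> ys) ! i = \<one>\<^bsub>?P\<^esub> ! i"
      using ring_hom_memE(4)[OF hom[OF i]] by simp
  qed (use xs ys in simp_all)
  ultimately show ?thesis
    using xs ys unfolding Units_def by blast
qed

lemma unit_powers_RDirProd_list_iff:
  "xs \<in> unit_powers (RDirProd_list Rs) k \<longleftrightarrow>
     length xs = length Rs \<and> (\<forall>i < length Rs. xs ! i \<in> unit_powers (Rs ! i) k)"
proof (intro iffI conjI allI impI)
  let ?P = "RDirProd_list Rs"
  interpret P: ring ?P by (rule ring_RDirProd_list)
  assume "xs \<in> unit_powers ?P k"
  then obtain ys where ys: "ys \<in> Units ?P" "xs = ys [^]\<^bsub>?P\<^esub> k"
    by (auto simp: unit_powers_def)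
  then show "length xs = length Rs"
    using RDirProd_list_carrier_mem(1)[OF P.nat_pow_closed[OF P.Units_closed]] by blast
  fix i assume i: "i < length Rs"
  show "xs ! i \<in> unit_powers (Rs ! i) k"
    using ys i Units_ring_hom_closed[OF nth_RDirProd_list_ring_hom[OF i] ys(1)]
    by (auto simp: unit_powers_def nth_pow_RDirProd_list P.Units_closed)
next
  let ?P = "RDirProd_list Rs"
  interpret P: ring ?P by (rule ring_RDirProd_list)
  assume xs: "length xs = length Rs \<and> (\<forall>i < length Rs. xs ! i \<in> unit_powers (Rs ! i) k)"
  then obtain f where f: "f i \<in> Units (Rs ! i)" "xs ! i = f i [^]\<^bsub>Rs ! i\<^esub> k"
    if "i < length Rs" for i
    unfolding unit_powers_def by simp metis
  define ys where "ys = map f [0..<length Rs]"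
  have ys: "ys \<in> Units ?P"
    using f(1) by (intro Units_RDirProd_listI) (simp_all add: ys_def)
  have "xs = ys [^]\<^bsub>?P\<^esub> k"
  proof (rule nth_equalityI)
    show "length xs = length (ys [^]\<^bsub>?P\<^esub> k)"
      using xs RDirProd_list_carrier_mem(1)[OF P.nat_pow_closed[OF P.Units_closed[OF ys]]]
      by metis
    show "xs ! i = (ys [^]\<^bsub>?P\<^esub> k) ! i" if "i < length xs" for i
      using that xs ys f(2) by (simp add: nth_pow_RDirProd_list P.Units_closed) (simp add: ys_def)
  qed
  then show "xs \<in> unit_powers ?P k"
    using ys by (auto simp: unit_powers_def)
qed

end

section \<open>Unit powers and their negatives\<close>

lemma (in ring) unit_powers_closed: "x \<in> unit_powers R k \<Longrightarrow> x \<in> carrier R"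
  by (auto simp: unit_powers_def)

lemma (in ring) one_in_unit_powers: "\<one> \<in> unit_powers R k"
  unfolding unit_powers_def by (metis (mono_tags, lifting) CollectI Units_one_closed nat_pow_one)

lemma (in ring) sym_unit_powers_iff:
  assumes "x \<in> carrier R"
  shows "x \<in> sym_unit_powers R k \<longleftrightarrow> x \<in> unit_powers R k \<or> \<ominus> x \<in> unit_powers R k"
  using assms unit_powers_closed by (force simp: sym_unit_powers_def)

text \<open>A sign is absorbed by a \<open>k\<close>-th power: if \<open>- 1 = y\<^sup>k\<close> then \<open>- z\<^sup>k = (y z)\<^sup>k\<close>. Commutativity of
  the ring enters here.\<close>

lemma (in cring) minus_unit_powers:
  assumes "\<ominus> \<one> \<in> unit_powers R k" "x \<in> unit_powers R k"
  shows "\<ominus> x \<in> unit_powers R k"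
proof -
  obtain y z where yz: "y \<in> Units R" "\<ominus> \<one> = y [^] k" "z \<in> Units R" "x = z [^] k"
    using assms by (auto simp: unit_powers_def)
  then have "x \<in> carrier R"
    by (simp add: Units_closed)
  then have "\<ominus> x = \<ominus> \<one> \<otimes> x"
    by (simp add: l_minus)
  also have "\<dots> = (y \<otimes> z) [^] k"
    using yz Units_closed by (simp add: nat_pow_distrib)
  finally show ?thesis
    using yz(1,3) by (auto simp: unit_powers_def)
qed

text \<open>Symmetrizing does not commute with products: a single sign has to serve for all components.\<close>

lemma sym_unit_powers_RDirProd_list_iff:
  assumes "\<And>S. S \<in> set Rs \<Longrightarrow> ring S" and "xs \<in> carrier (RDirProd_list Rs)"
  shows "xs \<in> sym_unit_powers (RDirProd_list Rs) k \<longleftrightarrow>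
    (\<forall>i < length Rs. xs ! i \<in> unit_powers (Rs ! i) k) \<or>
    (\<forall>i < length Rs. \<ominus>\<^bsub>Rs ! i\<^esub> (xs ! i) \<in> unit_powers (Rs ! i) k)"
proof -
  interpret ring "RDirProd_list Rs" by (rule ring_RDirProd_list[OF assms(1)])
  note len = RDirProd_list_carrier_mem(1)
  show ?thesis
    using assms len[OF assms(2)] len[OF a_inv_closed[OF assms(2)]]
    by (simp add: sym_unit_powers_iff unit_powers_RDirProd_list_iff nth_minus_RDirProd_list)
qed

section \<open>Isomorphisms of Cayley graphs\<close>

lemma pair_wf_digraph_cayley_graph: "pair_wf_digraph (cayley_graph A S)"
  by unfold_locales (auto simp: cayley_graph_def)

lemma graph_isoI:
  assumes "pair_wf_digraph G" and "inj_on f (pverts G)"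
    and "pverts H = f ` pverts G" and "parcs H = map_prod f f ` parcs G"
  shows "graph_iso G H"
proof -
  interpret pair_wf_digraph G by fact
  let ?h = "\<lparr>iso_verts = f, iso_arcs = map_prod f f, iso_head = snd, iso_tail = fst\<rparr>"
  have "parcs G \<subseteq> pverts G \<times> pverts G"
    using in_arcsD1 in_arcsD2 by auto
  then have "inj_on (map_prod f f) (parcs G)"
    using map_prod_inj_on[OF assms(2,2)] inj_on_subset by blast
  then have "pre_digraph.digraph_isomorphism (with_proj G) ?h"
    using assms(2) wf_digraph_axioms by (simp add: digraph_isomorphism_def)
  moreover have "with_proj H = app_iso ?h (with_proj G)"
    using assms(3,4) by (simp add: with_proj_def app_iso_def)
  ultimately show ?thesis
    unfolding digraph_iso_def by blast
qed

text \<open>The number of arcs is the invariant that tells the two graphs of the theorem apart.\<close>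

lemma graph_iso_card_parcs:
  assumes "graph_iso G H"
  shows "card (parcs G) = card (parcs H)"
proof -
  obtain h where h: "pre_digraph.digraph_isomorphism (with_proj G) h"
      "with_proj H = app_iso h (with_proj G)"
    using assms by (auto simp: digraph_iso_def)
  have "parcs H = iso_arcs h ` parcs G"
    using arg_cong[OF h(2), of arcs] by simp
  moreover have "inj_on (iso_arcs h) (parcs G)"
    using pre_digraph.digraph_isomorphism_inj_on_arcs[OF h(1)] by simp
  ultimately show ?thesis
    by (simp add: card_image)
qed

lemma ring_iso_image_sym_unit_powers_subset:
  assumes "ring R" "ring S" "h \<in> ring_iso R S"
  shows "h ` sym_unit_powers R k \<subseteq> sym_unit_powers S k"
proof -
  interpret ring_hom_ring R S h
    using assms by (intro ring_hom_ringI2) (auto simp: ring_iso_def)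
  have pow: "h (x [^]\<^bsub>R\<^esub> k) = h x [^]\<^bsub>S\<^esub> k" if "x \<in> carrier R" for x
    using that by (induction k) simp_all
  have "h x \<in> unit_powers S k" if "x \<in> unit_powers R k" for x
    using that Units_ring_hom_closed[OF homh] pow[OF R.Units_closed]
    unfolding unit_powers_def by blast
  then show ?thesis
    using R.unit_powers_closed by (fastforce simp: sym_unit_powers_def)
qed

lemma graph_iso_sym_unitary_cayley_graph:
  assumes "ring R" "ring S" "h \<in> ring_iso R S"
  shows "graph_iso (sym_unitary_cayley_graph R k) (sym_unitary_cayley_graph S k)"
proof (rule graph_isoI)
  interpret ring_hom_ring R S h
    using assms by (intro ring_hom_ringI2) (auto simp: ring_iso_def)
  have bij: "bij_betw h (carrier R) (carrier S)"
    using assms(3) by (simp add: ring_iso_def)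
  \<comment> \<open>Both \<open>h\<close> and its inverse send connection set into connection set; hence \<open>h\<close> also reflects
    membership.\<close>
  define g where "g = inv_into (carrier R) h"
  have g: "g \<in> ring_iso S R"
    unfolding g_def by (rule ring_iso_set_sym[OF assms(1,3)])
  have gh: "g (h x) = x" if "x \<in> carrier R" for x
    using that bij by (simp add: g_def bij_betw_inv_into_left)
  have diff: "h (w \<ominus>\<^bsub>R\<^esub> v) = h w \<ominus>\<^bsub>S\<^esub> h v" if "v \<in> carrier R" "w \<in> carrier R" for v w
    using that by (simp add: a_minus_def)
  have arc: "h x \<in> sym_unit_powers S k \<longleftrightarrow> x \<in> sym_unit_powers R k" if "x \<in> carrier R" for x
    using ring_iso_image_sym_unit_powers_subset[OF assms, of k] gh[OF that]
      ring_iso_image_sym_unit_powers_subset[OF assms(2,1) g, of k] by (metis image_subset_iff)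
  show "pair_wf_digraph (sym_unitary_cayley_graph R k)"
    by (simp add: sym_unitary_cayley_graph_def pair_wf_digraph_cayley_graph)
  show "inj_on h (pverts (sym_unitary_cayley_graph R k))"
    using bij by (simp add: sym_unitary_cayley_graph_def cayley_graph_def bij_betw_def)
  show "pverts (sym_unitary_cayley_graph S k) = h ` pverts (sym_unitary_cayley_graph R k)"
    using bij by (simp add: sym_unitary_cayley_graph_def cayley_graph_def bij_betw_def)
  have "{(v, w). v \<in> carrier S \<and> w \<in> carrier S \<and> w \<ominus>\<^bsub>S\<^esub> v \<in> sym_unit_powers S k} =
    map_prod h h ` {(v, w). v \<in> carrier R \<and> w \<in> carrier R \<and> w \<ominus>\<^bsub>R\<^esub> v \<in> sym_unit_powers R k}"
    (is "?A = ?B")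
  proof
    show "?B \<subseteq> ?A"
      by (auto simp: arc diff[symmetric])
    show "?A \<subseteq> ?B"
    proof (rule subrelI)
      fix v' w' assume vw': "(v', w') \<in> ?A"
      then have "v' \<in> h ` carrier R" "w' \<in> h ` carrier R"
        using bij by (auto simp: bij_betw_def)
      then obtain v w where "v \<in> carrier R" "w \<in> carrier R" "v' = h v" "w' = h w"
        by blast
      then show "(v', w') \<in> ?B"
        using vw' by (auto simp: arc diff[symmetric])
    qed
  qed
  then show "parcs (sym_unitary_cayley_graph S k) =
      map_prod h h ` parcs (sym_unitary_cayley_graph R k)"
    by (simp add: sym_unitary_cayley_graph_def cayley_graph_def)
qed

section \<open>Comparison with the Kronecker product\<close>

text \<open>Componentwise adjacency is again a condition on the difference of the end points, taken in the
  product ring. This makes the Kronecker product comparable with the Cayley graph of the product.\<close>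

lemma parcs_kronecker_sym_unitary_iff:
  assumes "\<And>S. S \<in> set Rs \<Longrightarrow> ring S"
  shows "(v, w) \<in> parcs (kronecker_product (map (\<lambda>S. sym_unitary_cayley_graph S k) Rs)) \<longleftrightarrow>
    v \<in> carrier (RDirProd_list Rs) \<and> w \<in> carrier (RDirProd_list Rs) \<and>
    (\<forall>i < length Rs. (w \<ominus>\<^bsub>RDirProd_list Rs\<^esub> v) ! i \<in> sym_unit_powers (Rs ! i) k)"
proof -
  have "v \<in> carrier (RDirProd_list Rs) \<longleftrightarrow>
      length v = length Rs \<and> (\<forall>i < length Rs. v ! i \<in> carrier (Rs ! i))" for v
    using RDirProd_list_carrier_mem RDirProd_list_carrier_memI by blast
  then show ?thesis
    using assms nth_diff_RDirProd_list[OF assms]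
    by (auto simp: kronecker_product_def sym_unitary_cayley_graph_def cayley_graph_def)
qed

lemma pverts_kronecker_sym_unitary:
  "pverts (kronecker_product (map (\<lambda>S. sym_unitary_cayley_graph S k) Rs)) =
    pverts (sym_unitary_cayley_graph (RDirProd_list Rs) k)"
  by (auto simp: kronecker_product_def sym_unitary_cayley_graph_def cayley_graph_def
      RDirProd_list_carrier_mem intro: RDirProd_list_carrier_memI)

lemma parcs_RDirProd_list_subset:
  assumes "\<And>S. S \<in> set Rs \<Longrightarrow> ring S"
  shows "parcs (sym_unitary_cayley_graph (RDirProd_list Rs) k) \<subseteq>
    parcs (kronecker_product (map (\<lambda>S. sym_unitary_cayley_graph S k) Rs))"
proof (rule subrelI)
  let ?P = "RDirProd_list Rs"
  interpret P: ring ?P by (rule ring_RDirProd_list[OF assms])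
  fix v w assume "(v, w) \<in> parcs (sym_unitary_cayley_graph ?P k)"
  then have vw: "v \<in> carrier ?P" "w \<in> carrier ?P" "w \<ominus>\<^bsub>?P\<^esub> v \<in> sym_unit_powers ?P k"
    by (auto simp: sym_unitary_cayley_graph_def cayley_graph_def)
  have "(w \<ominus>\<^bsub>?P\<^esub> v) ! i \<in> sym_unit_powers (Rs ! i) k" if i: "i < length Rs" for i
    using sym_unit_powers_RDirProd_list_iff[OF assms P.minus_closed[OF vw(2,1)]] vw(3) i
      ring.sym_unit_powers_iff[OF assms[OF nth_mem[OF i]]
        RDirProd_list_carrier_mem(2)[OF P.minus_closed[OF vw(2,1)] i]]
    by blast
  then show "(v, w) \<in> parcs (kronecker_product (map (\<lambda>S. sym_unitary_cayley_graph S k) Rs))"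
    using vw assms by (simp add: parcs_kronecker_sym_unitary_iff)
qed

text \<open>A difference whose components lie in the \<open>T\<^sub>i\<close> has, at each index, a sign that works. A common
  sign can be found for all such differences exactly when at most one index has signs that matter.\<close>

lemma sym_unitary_cayley_graph_eq_kronecker_iff:
  assumes crings: "\<And>S. S \<in> set Rs \<Longrightarrow> cring S"
  shows "sym_unitary_cayley_graph (RDirProd_list Rs) k =
      kronecker_product (map (\<lambda>S. sym_unitary_cayley_graph S k) Rs) \<longleftrightarrow>
    (\<exists>\<^sub>\<le>\<^sub>1 j. j < length Rs \<and> \<ominus>\<^bsub>Rs ! j\<^esub> \<one>\<^bsub>Rs ! j\<^esub> \<notin> unit_powers (Rs ! j) k)"
    (is "?G = ?K \<longleftrightarrow> (\<exists>\<^sub>\<le>\<^sub>1 j. ?bad j)")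
proof
  let ?P = "RDirProd_list Rs"
  have rings: "ring S" if "S \<in> set Rs" for S
    using crings[OF that] by (rule cring.axioms(1))
  interpret P: ring ?P by (rule ring_RDirProd_list[OF rings])
  assume eq: "?G = ?K"
  show "\<exists>\<^sub>\<le>\<^sub>1 j. ?bad j"
  proof (rule Uniq_I, rule ccontr)
    fix j l assume j: "?bad j" and l: "?bad l" and "j \<noteq> l"
    \<comment> \<open>a tuple of elements of the \<open>T\<^sub>i\<close> that needs opposite signs at \<open>j\<close> and \<open>l\<close>\<close>
    define t where "t = (\<one>\<^bsub>?P\<^esub>) [j := \<ominus>\<^bsub>Rs ! j\<^esub> \<one>\<^bsub>Rs ! j\<^esub>]"
    have t_nth: "t ! i = (if i = j then \<ominus>\<^bsub>Rs ! i\<^esub> \<one>\<^bsub>Rs ! i\<^esub> else \<one>\<^bsub>Rs ! i\<^esub>)"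
      if "i < length Rs" for i
      using that RDirProd_list_carrier_mem(1)[OF P.one_closed]
        ring_hom_memE(4)[OF nth_RDirProd_list_ring_hom[OF that]]
      by (simp add: t_def nth_list_update)
    have t: "t ! i \<in> carrier (Rs ! i) \<and> t ! i \<in> sym_unit_powers (Rs ! i) k"
      if "i < length Rs" for i
    proof -
      interpret ring "Rs ! i" using rings that by simp
      have "\<one>\<^bsub>Rs ! i\<^esub> \<in> carrier (Rs ! i) \<and> \<one>\<^bsub>Rs ! i\<^esub> \<in> sym_unit_powers (Rs ! i) k"
        "\<ominus>\<^bsub>Rs ! i\<^esub> \<one>\<^bsub>Rs ! i\<^esub> \<in> carrier (Rs ! i) \<and>
          \<ominus>\<^bsub>Rs ! i\<^esub> \<one>\<^bsub>Rs ! i\<^esub> \<in> sym_unit_powers (Rs ! i) k"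
        by (simp_all add: sym_unit_powers_iff one_in_unit_powers)
      then show ?thesis
        using t_nth[OF that] by metis
    qed
    have carr: "t \<in> carrier ?P"
      using t RDirProd_list_carrier_mem(1)[OF P.one_closed]
      by (intro RDirProd_list_carrier_memI) (simp_all add: t_def)
    then have "t \<ominus>\<^bsub>?P\<^esub> \<zero>\<^bsub>?P\<^esub> = t"
      by (simp add: a_minus_def)
    then have "(\<zero>\<^bsub>?P\<^esub>, t) \<in> parcs ?K"
      using t carr rings by (simp add: parcs_kronecker_sym_unitary_iff)
    then have "t \<in> sym_unit_powers ?P k"
      unfolding eq[symmetric] using \<open>t \<ominus>\<^bsub>?P\<^esub> \<zero>\<^bsub>?P\<^esub> = t\<close>
      by (simp add: sym_unitary_cayley_graph_def cayley_graph_def)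
    \<comment> \<open>Either common sign puts \<open>- 1\<close> into a set of unit powers, at \<open>j\<close> or at \<open>l\<close>.\<close>
    then have "t ! j \<in> unit_powers (Rs ! j) k \<or> \<ominus>\<^bsub>Rs ! l\<^esub> (t ! l) \<in> unit_powers (Rs ! l) k"
      using sym_unit_powers_RDirProd_list_iff[OF rings carr] j l by blast
    then show False
      using j l \<open>j \<noteq> l\<close> by (simp add: t_nth)
  qed
next
  let ?P = "RDirProd_list Rs"
  have rings: "ring S" if "S \<in> set Rs" for S
    using crings[OF that] by (rule cring.axioms(1))
  interpret P: ring ?P by (rule ring_RDirProd_list[OF rings])
  assume uniq: "\<exists>\<^sub>\<le>\<^sub>1 j. ?bad j"
  have "parcs ?K \<subseteq> parcs ?G"
  proof (rule subrelI)
    fix v w assume "(v, w) \<in> parcs ?K"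
    then have vw: "v \<in> carrier ?P" "w \<in> carrier ?P"
      and T: "\<And>i. i < length Rs \<Longrightarrow> (w \<ominus>\<^bsub>?P\<^esub> v) ! i \<in> sym_unit_powers (Rs ! i) k"
      using rings by (simp_all add: parcs_kronecker_sym_unitary_iff)
    define x where "x = w \<ominus>\<^bsub>?P\<^esub> v"
    have x: "x \<in> carrier ?P"
      using vw by (simp add: x_def)
    have pm: "x ! i \<in> unit_powers (Rs ! i) k \<or> \<ominus>\<^bsub>Rs ! i\<^esub> (x ! i) \<in> unit_powers (Rs ! i) k"
      if "i < length Rs" for i
      using T[OF that] that x rings ring.sym_unit_powers_iff[of "Rs ! i" "x ! i"]
      by (simp add: x_def[symmetric] RDirProd_list_carrier_mem(2))
    \<comment> \<open>An index at which the positive sign fails is the exceptional one, so the negative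
      sign works at all others.\<close>
    have "\<forall>i < length Rs. \<ominus>\<^bsub>Rs ! i\<^esub> (x ! i) \<in> unit_powers (Rs ! i) k"
      if j: "j < length Rs" "x ! j \<notin> unit_powers (Rs ! j) k" for j
    proof (intro allI impI)
      fix i assume i: "i < length Rs"
      have "?bad j"
      proof (rule ccontr)
        assume "\<not> ?bad j"
        moreover interpret cring "Rs ! j" using crings j by simp
        have "x ! j \<in> carrier (Rs ! j)"
          using x j by (simp add: RDirProd_list_carrier_mem(2))
        ultimately show False
          using pm[OF j(1)] j minus_unit_powers[of k "\<ominus>\<^bsub>Rs ! j\<^esub> (x ! j)"] by simp
      qed
      then have "i = j \<or> \<not> ?bad i"
        using uniq by (blast dest: Uniq_D)
      then show "\<ominus>\<^bsub>Rs ! i\<^esub> (x ! i) \<in> unit_powers (Rs ! i) k"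
        using pm[OF i] j i crings cring.minus_unit_powers[of "Rs ! i" k "x ! i"] by auto
    qed
    then have "x \<in> sym_unit_powers ?P k"
      using sym_unit_powers_RDirProd_list_iff[OF rings x] by blast
    then show "(v, w) \<in> parcs ?G"
      using vw by (simp add: x_def sym_unitary_cayley_graph_def cayley_graph_def)
  qed
  then have "parcs ?G = parcs ?K"
    using parcs_RDirProd_list_subset[OF rings] by blast
  then show "?G = ?K"
    by (simp add: pverts_kronecker_sym_unitary)
qed

theorem theorem7p3:
  fixes R :: "('a, 'm) ring_scheme" and Rs :: "('b, 'n) ring_scheme list" and k :: nat
  assumes "cring R" and "finite (carrier R)"
    and "Rs \<noteq> []" and "\<And>S. S \<in> set Rs \<Longrightarrow> local_ring S"
    and "R \<simeq> RDirProd_list Rs"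
    and "k > 0"
  shows "graph_iso (sym_unitary_cayley_graph R k)
                   (kronecker_product (map (\<lambda>S. sym_unitary_cayley_graph S k) Rs))
         \<longleftrightarrow> (\<exists>\<^sub>\<le>\<^sub>1 j. j < length Rs \<and>
                \<ominus>\<^bsub>Rs ! j\<^esub> \<one>\<^bsub>Rs ! j\<^esub> \<notin> unit_powers (Rs ! j) k)"
proof -
  let ?P = "RDirProd_list Rs"
  let ?G = "sym_unitary_cayley_graph ?P k"
  let ?K = "kronecker_product (map (\<lambda>S. sym_unitary_cayley_graph S k) Rs)"
  have crings: "cring S" if "S \<in> set Rs" for S
    using assms(4)[OF that] by (simp add: local_ring_def)
  have rings: "ring S" if "S \<in> set Rs" for S
    using crings[OF that] by (rule cring.axioms(1))
  have ring_R: "ring R"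
    using assms(1) by (rule cring.axioms(1))
  obtain h where h: "h \<in> ring_iso R ?P"
    using assms(5) by (auto simp: is_ring_iso_def)
  have iso: "graph_iso (sym_unitary_cayley_graph R k) ?G"
    by (rule graph_iso_sym_unitary_cayley_graph[OF ring_R ring_RDirProd_list[OF rings] h])
  have "finite (carrier ?P)"
    using h assms(2) by (auto simp: ring_iso_def dest: bij_betw_finite)
  then have "finite (carrier ?P \<times> carrier ?P)"
    by simp
  moreover have "parcs ?K \<subseteq> carrier ?P \<times> carrier ?P"
    using rings by (auto simp: parcs_kronecker_sym_unitary_iff)
  ultimately have fin: "finite (parcs ?K)"
    by (rule rev_finite_subset)
  have "graph_iso (sym_unitary_cayley_graph R k) ?K \<longleftrightarrow> ?G = ?K"
  proof
    assume "graph_iso (sym_unitary_cayley_graph R k) ?K"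
    then have "card (parcs ?G) = card (parcs ?K)"
      using graph_iso_card_parcs[OF iso] graph_iso_card_parcs by metis
    then have "parcs ?G = parcs ?K"
      using card_subset_eq[OF fin] parcs_RDirProd_list_subset[OF rings] by blast
    then show "?G = ?K"
      by (simp add: pverts_kronecker_sym_unitary)
  next
    assume "?G = ?K"
    then show "graph_iso (sym_unitary_cayley_graph R k) ?K"
      using iso by simp
  qed
  also have "\<dots> \<longleftrightarrow> (\<exists>\<^sub>\<le>\<^sub>1 j. j < length Rs \<and>
                \<ominus>\<^bsub>Rs ! j\<^esub> \<one>\<^bsub>Rs ! j\<^esub> \<notin> unit_powers (Rs ! j) k)"
    by (rule sym_unitary_cayley_graph_eq_kronecker_iff[OF crings])
  finally show ?thesis .
qed

end
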